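(* Let $H$ and $K$ be the $8\times 8$ real symmetric matrices $$H=\begin{pmatrix} -122 & 0 & 12 & 18 & -30 & 18 & 26 & 10 \\ 0 & -122 & -6 & -12 & -16 & -28 & 20 & -16 \\ 12 & -6 & -218 & 0 & 44 & 8 & 24 & 12 \\ 18 & -12 & 0 & -218 & -2 & -34 & -10 & 22 \\ -30 & -16 & 44 & -2 & -216 & 0 & -12 & -8 \\ 18 & -28 & 8 & -34 & 0 & -216 & -8 & 36 \\ 26 & 20 & 24 & -10 & -12 & -8 & -120 & 0 \\ 10 & -16 & 12 & 22 & -8 & 36 & 0 & -120 \end{pmatrix},$$ $$K=\mathrm{diag}(-4,-4,4,4,-8,-8,8,8).$$ Let $X=\begin{pmatrix}1&0\\ 0&0\end{pmatrix}$, $Y=\begin{pmatrix}0&1\\ 1&0\end{pmatrix}$, and $L=X\otimes H+Y\otimes K=\begin{pmatrix}H & K \\ K & 0\end{pmatrix}$. Then $L$ has only simple eigenvalues.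
   Context: $\otimes$ is the Kronecker product. A simple eigenvalue is one of multiplicity one, so the claim is that the $16\times16$ matrix $L$ has $16$ distinct eigenvalues. *)

theory Defs
  imports "Jordan_Normal_Form.Char_Poly"
begin

definition kronecker :: "'a::semiring_0 mat \<Rightarrow> 'a mat \<Rightarrow> 'a mat" (infixl "\<otimes>\<^sub>K" 70) where
  "A \<otimes>\<^sub>K B = Matrix.mat (dim_row A * dim_row B) (dim_col A * dim_col B)
     (\<lambda>(i, j). A $$ (i div dim_row B, j div dim_col B) * B $$ (i mod dim_row B, j mod dim_col B))"

definition H :: "real mat" where
  "H = mat_of_rows_list 8
    [[-122,    0,   12,   18,  -30,   18,   26,   10],
     [   0, -122,   -6,  -12,  -16,  -28,   20,  -16],
     [  12,   -6, -218,    0,   44,    8,   24,   12],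
     [  18,  -12,    0, -218,   -2,  -34,  -10,   22],
     [ -30,  -16,   44,   -2, -216,    0,  -12,   -8],
     [  18,  -28,    8,  -34,    0, -216,   -8,   36],
     [  26,   20,   24,  -10,  -12,   -8, -120,    0],
     [  10,  -16,   12,   22,   -8,   36,    0, -120]]"

definition K :: "real mat" where
  "K = mat_diag 8 (\<lambda>i. [-4, -4, 4, 4, -8, -8, 8, 8] ! i)"

definition X :: "real mat" where
  "X = mat_of_rows_list 2 [[1, 0], [0, 0]]"

definition Y :: "real mat" where
  "Y = mat_of_rows_list 2 [[0, 1], [1, 0]]"

definition L :: "real mat" where
  "L = X \<otimes>\<^sub>K H + Y \<otimes>\<^sub>K K"

(* Multiplicity is algebraic: the order of the root of the characteristic polynomial. *)
definition simple_eigenvalue :: "'a::idom mat \<Rightarrow> 'a \<Rightarrow> bool" where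
  "simple_eigenvalue A x \<longleftrightarrow> eigenvalue A x \<and> Polynomial.order x (char_poly A) = 1"

lemma L_block: "L = four_block_mat H K K (0\<^sub>m 8 8)"
proof (rule eq_matI)
  have dims: "dim_row H = 8" "dim_col H = 8" "dim_row K = 8" "dim_col K = 8"
    "dim_row X = 2" "dim_col X = 2" "dim_row Y = 2" "dim_col Y = 2"
    by (simp_all add: H_def K_def X_def Y_def mat_of_rows_list_def mat_diag_def)
  show "dim_row L = dim_row (four_block_mat H K K (0\<^sub>m 8 8))"
    "dim_col L = dim_col (four_block_mat H K K (0\<^sub>m 8 8))"
    by (simp_all add: L_def kronecker_def dims)
  fix i j
  assume "i < dim_row (four_block_mat H K K (0\<^sub>m 8 8))"
    and "j < dim_col (four_block_mat H K K (0\<^sub>m 8 8))"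
  then have ij: "i < 16" "j < 16"
    by (simp_all add: dims)
  have divmod: "(n < 8 \<and> n div 8 = 0 \<and> n mod 8 = n) \<or> (\<not> n < 8 \<and> n div 8 = 1 \<and> n mod 8 = n - 8)"
    if "n < 16" for n :: nat
    using that by presburger
  have XY: "X $$ (0, 0) = 1" "X $$ (0, 1) = 0" "X $$ (1, 0) = 0" "X $$ (1, 1) = 0"
    "Y $$ (0, 0) = 0" "Y $$ (0, 1) = 1" "Y $$ (1, 0) = 1" "Y $$ (1, 1) = 0"
    by (simp_all add: X_def Y_def mat_of_rows_list_def)
  have "L $$ (i, j) = X $$ (i div 8, j div 8) * H $$ (i mod 8, j mod 8)
      + Y $$ (i div 8, j div 8) * K $$ (i mod 8, j mod 8)"
    using ij by (simp add: L_def kronecker_def dims)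
  also have "\<dots> = four_block_mat H K K (0\<^sub>m 8 8) $$ (i, j)"
    using divmod[OF ij(1)] divmod[OF ij(2)] ij
    by (elim disjE) (simp_all add: dims XY XY[unfolded One_nat_def])
  finally show "L $$ (i, j) = four_block_mat H K K (0\<^sub>m 8 8) $$ (i, j)" .
qed

end

theory Submission
  imports Defs
begin

text \<open>
  Why the eigenvalues are simple: a real polynomial of degree 16 that takes values of alternating
  sign at 17 increasing points has a root in each of the 16 gaps, hence 16 distinct roots, and
  there is no degree left for a multiple one
  (\<open>simple_roots_of_alternating_signs\<close>).

  The signs come from exact determinants.  Since the lower right block of \<open>x I - L\<close> is the scalar
  matrix \<open>x I\<close>, the block determinant formula reduces the \<open>16 \<times> 16\<close> determinant to that of the
  \<open>8 \<times> 8\<close> quadratic pencil \<open>x\<^sup>2 I - x H - K\<^sup>2\<close>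
  (\<open>poly_char_poly_zero_corner\<close>).  At \<open>x = p / q\<close> this pencil, multiplied by
  \<open>q\<^sup>2\<close>, has integer entries, and fraction-free Gaussian elimination
  (\<open>det_eq_bareiss\<close>) evaluates its determinant.

  The choice of the points reflects the position of the spectrum.  \<open>H\<close> dominates \<open>K\<close>,
  so eight eigenvalues lie near those of \<open>H\<close> and are negative, and the other eight
  lie near those of the positive definite matrix \<open>- K H\<^sup>-\<^sup>1 K\<close>, between \<open>0\<close> and \<open>1\<close>.
  The eigenvalues occur in eight pairs of neighbours; the relatively closest one, near \<open>-186.11\<close>,
  has members about \<open>0.003\<close> apart.  Every second point separates the two members of a pair.
\<close>

section \<open>Counting roots by sign changes\<close>

text \<open>
  The roots found in the gaps already exhaust the degree, which bounds the sum of the orders of all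
  roots; so each order is 1.
\<close>

lemma simple_roots_of_alternating_signs:
  fixes p :: "real poly"
  assumes sorted: "sorted_wrt (<) ts" and len: "length ts = Suc (degree p)"
    and sign: "\<And>i. i \<le> degree p \<Longrightarrow> (-1) ^ i * poly p (ts ! i) > 0"
  shows "card {x. poly p x = 0} = degree p" and "poly p x = 0 \<Longrightarrow> Polynomial.order x p = 1"
proof -
  have p: "p \<noteq> 0" using sign[of 0] by auto
  let ?R = "{x. poly p x = 0}"
  have fin: "finite ?R" using p by (rule poly_roots_finite)
  have "poly p (ts ! i) * poly p (ts ! Suc i) < 0" if "i < degree p" for i
    using sign[of i] sign[of "Suc i"] that
    by (cases "even i") (auto simp: mult_less_0_iff)
  then have "\<exists>x. ts ! i < x \<and> x < ts ! Suc i \<and> poly p x = 0" if "i < degree p" for i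
    using poly_IVT[of "ts ! i" "ts ! Suc i" p] sorted len that
    by (auto simp: sorted_wrt_iff_nth_less)
  then obtain r where r: "\<And>i. i < degree p \<Longrightarrow> ts ! i < r i \<and> r i < ts ! Suc i \<and> poly p (r i) = 0"
    by metis
  have "r i < r j" if "i < j" "j < degree p" for i j
  proof -
    have "ts ! Suc i \<le> ts ! j"
      using sorted_wrt_nth_less[OF sorted, of "Suc i" j] that len by (cases "Suc i = j") auto
    then show ?thesis using r[of i] r[of j] that by fastforce
  qed
  then have "inj_on r {..<degree p}"
    by (intro inj_onI) (metis lessThan_iff linorder_neqE_nat less_irrefl)
  then have ge: "degree p \<le> card ?R"
    using card_inj_on_le[of r "{..<degree p}" ?R] r fin by auto
  have ord: "order x p \<ge> 1" if "x \<in> ?R" for x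
    using that p by (simp add: Suc_le_eq order_gt_0_iff)
  have le: "(\<Sum>x\<in>?R. order x p) \<le> degree p"
    using size_proots_le[of p] p by (simp add: size_multiset_overloaded_eq)
  have "card ?R \<le> (\<Sum>x\<in>?R. order x p)"
    using sum_mono[of ?R "\<lambda>_. 1" "\<lambda>x. order x p"] ord by simp
  then show card: "card ?R = degree p" using ge le by linarith
  assume x: "poly p x = 0"
  show "order x p = 1"
  proof (rule ccontr)
    assume "order x p \<noteq> 1"
    then have "1 < order x p" using ord[of x] x by simp
    then have "(\<Sum>x\<in>?R. 1) < (\<Sum>x\<in>?R. order x p)"
      using ord x fin by (intro sum_strict_mono_ex1) auto
    then show False using card le by simp
  qed
qed

section \<open>Determinants by fraction-free elimination\<close>

text \<open>
  Bareiss elimination on a list of rows, without row exchanges.  The argument \<open>d\<close> is the previous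
  pivot.  On an integer matrix with initial \<open>d = 1\<close> all intermediate entries are minors of
  that matrix: each division is exact and the numbers stay small, which is what makes the
  evaluations by rewriting feasible.  A vanishing pivot gives the value \<open>0\<close>, so that a nonzero
  value certifies that the elimination went through.
\<close>

fun bareiss :: "'a::field \<Rightarrow> 'a list list \<Rightarrow> 'a" where
  "bareiss d [] = d"
| "bareiss d (u # us) = (if hd u = 0 then 0 else
     bareiss (hd u) (map (\<lambda>v. map2 (\<lambda>x y. (hd u * y - hd v * x) / d) (tl u) (tl v)) us))"

lemma det_eliminate_first_column:
  fixes a :: "'a::field"
  assumes a: "a \<noteq> 0" and B: "B \<in> carrier_mat 1 n" and C: "C \<in> carrier_mat n 1"
    and D: "D \<in> carrier_mat n n"
  shows "det (four_block_mat (mat 1 1 (\<lambda>_. a)) B C D) = a * det (D - (1 / a) \<cdot>\<^sub>m (C * B))"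
proof -
  let ?a = "mat 1 1 (\<lambda>_. a)"
  let ?P = "four_block_mat (1\<^sub>m 1) (0\<^sub>m 1 n) ((1 / a) \<cdot>\<^sub>m C) (1\<^sub>m n)"
  let ?U = "four_block_mat ?a B (0\<^sub>m n 1) (D - (1 / a) \<cdot>\<^sub>m (C * B))"
  have "?P * ?U = four_block_mat ?a B C D"
    using a B C D
    by (subst mult_four_block_mat[of _ 1 1 _ n _ n _ _ 1 _ n])
      (auto intro!: cong_four_block_mat eq_matI simp: scalar_prod_def)
  moreover have "det (?P * ?U) = det ?P * det ?U"
    using B C D by (intro det_mult[of _ "1 + n"] four_block_carrier_mat) auto
  moreover have "det ?P = 1"
    using C by (subst det_four_block_mat_upper_right_zero[of _ 1 _ n]) auto
  moreover have "det ?U = a * det (D - (1 / a) \<cdot>\<^sub>m (C * B))"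
    using B C D by (subst det_four_block_mat_lower_left_zero[of _ 1 _ n]) (auto simp: det_single)
  ultimately show ?thesis by simp
qed

text \<open>
  The determinant is recovered as \<open>d ^ (n - 1) * bareiss d rs\<close>; the extra factor \<open>d\<close> on both
  sides lets the induction start at \<open>n = 0\<close>.  In the step, the matrix of the next stage is
  \<open>a / d\<close> times the Schur complement of the pivot \<open>a\<close>, which contributes \<open>(a / d) ^ n\<close> to its
  determinant; \<open>a ^ n\<close> is what the induction hypothesis supplies and \<open>d ^ n\<close> is what the
  claim asks for.
\<close>

lemma det_eq_bareiss:
  assumes "length rs = n" and "\<forall>r \<in> set rs. length r = n" and "bareiss d rs \<noteq> 0" and "d \<noteq> 0"
  shows "d * det (mat_of_rows_list n rs) = d ^ n * bareiss d rs"
  using assms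
proof (induction n arbitrary: d rs)
  case 0
  then show ?case by (simp add: mat_of_rows_list_def)
next
  case (Suc n)
  obtain u us where rs: "rs = u # us" "length us = n" using Suc.prems(1) by (cases rs) auto
  define a where "a = hd u"
  have us: "length (us ! i) = Suc n" if "i < n" for i
    using Suc.prems(2) rs that by auto
  have len: "length u = Suc n" using Suc.prems(2) rs by simp
  have hd: "u ! 0 = a" unfolding a_def using len by (subst hd_conv_nth) auto
  have hd_us: "hd (us ! i) = us ! i ! 0" if "i < n" for i
    using us[OF that] by (intro hd_conv_nth) auto
  define vs where "vs = map (\<lambda>v. map2 (\<lambda>x y. (a * y - hd v * x) / d) (tl u) (tl v)) us"
  have a: "a \<noteq> 0" and bar: "bareiss d rs = bareiss a vs"
    using Suc.prems(3) by (auto simp: rs vs_def a_def split: if_splits)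
  define B where "B = mat 1 n (\<lambda>(i, j). u ! Suc j)"
  define C where "C = mat n 1 (\<lambda>(i, j). us ! i ! 0)"
  define D where "D = mat n n (\<lambda>(i, j). us ! i ! Suc j)"
  define S where "S = D - (1 / a) \<cdot>\<^sub>m (C * B)"
  have BCD: "B \<in> carrier_mat 1 n" "C \<in> carrier_mat n 1" "D \<in> carrier_mat n n" "S \<in> carrier_mat n n"
    by (auto simp: B_def C_def D_def S_def)
  have "mat_of_rows_list (Suc n) rs = four_block_mat (mat 1 1 (\<lambda>_. a)) B C D"
    using len
    by (intro eq_matI) (auto simp: mat_of_rows_list_def rs B_def C_def D_def hd nth_Cons')
  then have det_rs: "det (mat_of_rows_list (Suc n) rs) = a * det S"
    using det_eliminate_first_column[OF a BCD(1-3)] by (simp add: S_def)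
  have "mat_of_rows_list n vs = (a / d) \<cdot>\<^sub>m S"
    using len us a Suc.prems(4)
    by (intro eq_matI)
      (auto simp: mat_of_rows_list_def vs_def rs S_def B_def C_def D_def scalar_prod_def hd_us nth_tl
        field_simps)
  then have det_vs: "a ^ n * det S = d ^ n * det (mat_of_rows_list n vs)"
    using BCD Suc.prems(4) by (simp add: det_smult power_divide)
  have IH: "a * det (mat_of_rows_list n vs) = a ^ n * bareiss a vs"
    using Suc.prems us len rs bar a by (intro Suc.IH) (auto simp: vs_def rs in_set_conv_nth)
  have "a ^ n * (a * det S) = d ^ n * (a * det (mat_of_rows_list n vs))"
    using det_vs by (simp add: mult.left_commute)
  also have "\<dots> = a ^ n * (d ^ n * bareiss a vs)"
    unfolding IH by (simp add: mult.left_commute)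
  finally have "a ^ n * (a * det S) = a ^ n * (d ^ n * bareiss a vs)" .
  then have "a * det S = d ^ n * bareiss a vs" using a by simp
  then show ?case by (simp add: det_rs bar)
qed

section \<open>The quadratic pencil\<close>

text \<open>
  The lower right block of \<open>t I - L\<close> is \<open>t I\<close>; being scalar, it commutes with the block
  \<open>- B\<close> next to it, which is what the block determinant formula asks for.
\<close>

lemma poly_char_poly_zero_corner:
  fixes A B :: "'a::field mat"
  assumes A: "A \<in> carrier_mat n n" and B: "B \<in> carrier_mat n n"
  shows "poly (char_poly (four_block_mat A B B (0\<^sub>m n n))) t
       = det (t\<^sup>2 \<cdot>\<^sub>m 1\<^sub>m n - t \<cdot>\<^sub>m A - B * B)"
proof -
  have "poly (char_poly (four_block_mat A B B (0\<^sub>m n n))) t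
      = det (- char_matrix (four_block_mat A B B (0\<^sub>m n n)) t)"
    using A B by (subst char_poly_matrix[of _ "n + n"]) auto
  also have "- char_matrix (four_block_mat A B B (0\<^sub>m n n)) t
      = four_block_mat (t \<cdot>\<^sub>m 1\<^sub>m n - A) (- B) (- B) (t \<cdot>\<^sub>m 1\<^sub>m n)"
    using A B by (intro eq_matI) (auto simp: char_matrix_def)
  also have "det \<dots> = det ((t \<cdot>\<^sub>m 1\<^sub>m n - A) * (t \<cdot>\<^sub>m 1\<^sub>m n) - (- B) * (- B))"
    using A B by (intro det_four_block_mat[of _ n]) auto
  also have "(t \<cdot>\<^sub>m 1\<^sub>m n - A) * (t \<cdot>\<^sub>m 1\<^sub>m n) - (- B) * (- B)
      = t\<^sup>2 \<cdot>\<^sub>m 1\<^sub>m n - t \<cdot>\<^sub>m A - B * B"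
    using A B
    by (intro eq_matI) (auto simp: power2_eq_square algebra_simps)
  finally show ?thesis .
qed

text \<open>The pencil at \<open>p / q\<close>, multiplied by \<open>q\<^sup>2\<close> so that integers \<open>p\<close> and \<open>q\<close> give integer entries.\<close>

definition pencil :: "real \<Rightarrow> real \<Rightarrow> real mat" where
  "pencil p q = p\<^sup>2 \<cdot>\<^sub>m 1\<^sub>m 8 - (p * q) \<cdot>\<^sub>m H - q\<^sup>2 \<cdot>\<^sub>m (K * K)"

lemma HK_carrier: "H \<in> carrier_mat 8 8" "K \<in> carrier_mat 8 8"
  by (rule carrier_matI; simp add: H_def K_def mat_of_rows_list_def mat_diag_def)+

lemma poly_char_poly_L:
  assumes q: "q \<noteq> 0" and nz: "bareiss 1 (mat_to_list (pencil p q)) \<noteq> 0"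
  shows "q ^ 16 * poly (char_poly L) (p / q) = bareiss 1 (mat_to_list (pencil p q))"
proof -
  let ?M = "(p / q)\<^sup>2 \<cdot>\<^sub>m 1\<^sub>m 8 - (p / q) \<cdot>\<^sub>m H - K * K"
  have dims: "dim_row (pencil p q) = 8" "dim_col (pencil p q) = 8"
    using HK_carrier by (auto simp: pencil_def)
  have "pencil p q = q\<^sup>2 \<cdot>\<^sub>m ?M"
    using q HK_carrier
    by (intro eq_matI) (auto simp: pencil_def power2_eq_square field_simps)
  then have "det (pencil p q) = q ^ 16 * det ?M"
    using HK_carrier by (simp add: det_smult flip: power_mult)
  moreover have "pencil p q = mat_of_rows_list 8 (mat_to_list (pencil p q))"
    using dims by (intro eq_matI) (auto simp: mat_to_list_def mat_of_rows_list_def)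
  moreover have "det (mat_of_rows_list 8 (mat_to_list (pencil p q)))
      = bareiss 1 (mat_to_list (pencil p q))"
    using det_eq_bareiss[of "mat_to_list (pencil p q)" 8 1] nz dims
    by (auto simp: mat_to_list_def)
  ultimately show ?thesis
    by (simp add: L_block poly_char_poly_zero_corner[OF HK_carrier])
qed

lemma mat_to_list_pencil:
  "mat_to_list (pencil p q) =
    [[p*p + 122*p*q - 16*q*q, 0, -12*p*q, -18*p*q, 30*p*q, -18*p*q, -26*p*q, -10*p*q],
     [0, p*p + 122*p*q - 16*q*q, 6*p*q, 12*p*q, 16*p*q, 28*p*q, -20*p*q, 16*p*q],
     [-12*p*q, 6*p*q, p*p + 218*p*q - 16*q*q, 0, -44*p*q, -8*p*q, -24*p*q, -12*p*q],
     [-18*p*q, 12*p*q, 0, p*p + 218*p*q - 16*q*q, 2*p*q, 34*p*q, 10*p*q, -22*p*q],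
     [30*p*q, 16*p*q, -44*p*q, 2*p*q, p*p + 216*p*q - 64*q*q, 0, 12*p*q, 8*p*q],
     [-18*p*q, 28*p*q, -8*p*q, 34*p*q, 0, p*p + 216*p*q - 64*q*q, 8*p*q, -36*p*q],
     [-26*p*q, -20*p*q, -24*p*q, 10*p*q, 12*p*q, 8*p*q, p*p + 120*p*q - 64*q*q, 0],
     [-10*p*q, 16*p*q, -12*p*q, -22*p*q, 8*p*q, -36*p*q, 0, p*p + 120*p*q - 64*q*q]]"
proof -
  have K2: "K * K = mat_diag 8 (\<lambda>i. [16, 16, 16, 16, 64, 64, 64, 64] ! i)"
    unfolding K_def mat_diag_diag
    by (intro eq_matI) (auto simp: mat_diag_def less_Suc_eq eval_nat_numeral)
  have 8: "[0..<8] = [0, 1, 2, 3, 4, 5, 6, 7::nat]" by (simp add: upt_rec)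
  show ?thesis
    unfolding pencil_def K2
    by (simp add: power2_eq_square mat_to_list_def mat_diag_def H_def mat_of_rows_list_def 8)
qed

section \<open>Separating the eigenvalues\<close>

text \<open>
  Numerators and denominators, kept apart so that the elimination works on integers.  The points at
  odd positions (counted from 0) split the eight pairs of neighbouring eigenvalues, with
  small denominators even in the narrow gaps in order to keep the integers short; those at even positions lie between pairs or outside the
  spectrum.
\<close>

definition separators :: "(real \<times> real) list" where
  "separators =
    [(-272, 1), (-2983, 11), (-200, 1), (-4839, 26), (-160, 1), (-3501, 25), (-100, 1), (-479, 6),
     (0, 1), (1, 14), (1, 10), (2, 15), (1, 5), (3, 10), (1, 2), (7, 11), (1, 1)]"

lemma pencil_signs:
  "list_all2 (\<lambda>s (p, q). 0 < s * bareiss 1 (mat_to_list (pencil p q)))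
     (map (\<lambda>i. (-1) ^ i) [0..<17]) separators"
proof -
  have "map (\<lambda>i. (-1) ^ i) [0..<17]
      = [1, -1, 1, -1, 1, -1, 1, -1, 1, -1, 1, -1, 1, -1, 1, -1, 1 :: real]"
    by (simp add: upt_rec)
  then show ?thesis by (simp add: separators_def mat_to_list_pencil)
qed

theorem proposition9:
  shows "(\<forall>x. eigenvalue L x \<longrightarrow> simple_eigenvalue L x) \<and> card {x. eigenvalue L x} = 16"
proof -
  let ?ts = "map (\<lambda>(p, q). p / q) separators"
  have L: "L \<in> carrier_mat 16 16"
    using four_block_carrier_mat[OF HK_carrier(1) zero_carrier_mat[of 8 8]]
    by (simp add: L_block)
  have deg: "degree (char_poly L) = 16" using degree_monic_char_poly[OF L] by simp
  have len: "length separators = 17" by (simp add: separators_def)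
  have sign: "(-1) ^ i * poly (char_poly L) (?ts ! i) > 0" if "i \<le> 16" for i
  proof -
    obtain p q where pq: "separators ! i = (p, q)" by fastforce
    have "(p, q) \<in> set separators" using that len pq nth_mem[of i separators] by simp
    then have q: "q \<noteq> 0" by (auto simp: separators_def)
    have pos: "0 < (-1) ^ i * bareiss 1 (mat_to_list (pencil p q))"
      using list_all2_nthD[OF pencil_signs, of i] that pq by simp
    then have "0 < (-1) ^ i * (q ^ 16 * poly (char_poly L) (p / q))"
      using q by (subst poly_char_poly_L) auto
    then have "0 < q ^ 16 * ((-1) ^ i * poly (char_poly L) (p / q))"
      by (simp add: mult.left_commute)
    moreover have "0 < q ^ 16" using q by (simp add: zero_less_power_eq)
    ultimately have "0 < (-1) ^ i * poly (char_poly L) (p / q)" by (rule zero_less_mult_pos)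
    then show ?thesis using that len pq by simp
  qed
  have "sorted_wrt (<) ?ts" by (simp add: separators_def)
  then have "card {x. poly (char_poly L) x = 0} = 16"
    and "\<And>x. poly (char_poly L) x = 0 \<Longrightarrow> order x (char_poly L) = 1"
    using simple_roots_of_alternating_signs[of ?ts "char_poly L"] sign deg len by auto
  then show ?thesis
    by (simp add: simple_eigenvalue_def eigenvalue_root_char_poly[OF L])
qed

end
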